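(* Let $\mu\in\mathbb{C}$ with $\operatorname{Re}(\mu)>-\frac12$, and for $m\in\{0,1,2,\dots\}$ and $b\in\left(\frac1{\sqrt2},1\right)$ let $$M_m(b):=\int_{E_4}\left(\cos\phi_{E_4}(x)\right)^{m}\left(1-\cos^2\phi_{E_4}(x)\right)^{\mu}w_{E_4}(x)\,dx .$$ Then: (i) for every $n\in\{0,1,2,\dots\}$, $\displaystyle\lim_{b\to \frac{1}{\sqrt2}^+}M_{2n+1}(b)=0$; (ii) for every $n\in\{0,1,2,\dots\}$, $\displaystyle\lim_{b\to1^-}M_{2n+1}(b)=\frac{(1)_n}{(\mu+\frac12)_{n+1}}$; (iii) for every $m\in\{0,1,2,\dots\}$, $\displaystyle\lim_{b\to1^-}M_m(b)=2\mu^H_m$, where $\displaystyle\mu_m^H:=\int_0^1x^m(1-x^2)^{\mu-1/2}\,dx$ is the half range ultraspherical moment.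
   Context: For $b\in[\frac1{\sqrt2},1)$ put $$E_4:=[-1,-b]\cup[-\sqrt{1-b^2},\sqrt{1-b^2}]\cup[b,1].$$ For (almost every) $x\in E_4$ define $$\cos\phi_{E_4}(x):=\sqrt{\frac{(x-\sqrt{1-b^2})(x+b)}{(x+\sqrt{1-b^2})(x-b)}}\;\cdot\;\frac{(x-b)(x+\sqrt{1-b^2})}{b\sqrt{1-b^2}},$$ $$w_{E_4}(x):=\sqrt{\frac{(x-\sqrt{1-b^2})(x+b)}{(1-x^2)(x-b)(x+\sqrt{1-b^2})}}.$$ Here $\cos\phi_{E_4}$ is just the name of a real-valued function, $\cos^2\phi_{E_4}(x)$ means $(\cos\phi_{E_4}(x))^2$, and square roots of nonnegative reals are nonnegative. For $t>0$, $t^\mu=e^{\mu\log t}$ with the real logarithm. The shifted factorial is $(a)_0:=1$, $(a)_n:=a(a+1)\cdots(a+n-1)$. *)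

theory Defs
  imports "HOL-Analysis.Analysis"
begin

definition E4 :: "real \<Rightarrow> real set" where
  "E4 b = {-1..-b} \<union> {-sqrt (1 - b^2)..sqrt (1 - b^2)} \<union> {b..1}"

(* For 1 / sqrt 2 <= b < 1 the radicands below are nonnegative on E4 b apart from the
   finitely many points where a denominator vanishes; at those points (a null set) the
   convention x / 0 = 0 applies. *)

definition cos_phi_E4 :: "real \<Rightarrow> real \<Rightarrow> real" where
  "cos_phi_E4 b x =
     sqrt (((x - sqrt (1 - b^2)) * (x + b)) / ((x + sqrt (1 - b^2)) * (x - b)))
     * (((x - b) * (x + sqrt (1 - b^2))) / (b * sqrt (1 - b^2)))"

definition w_E4 :: "real \<Rightarrow> real \<Rightarrow> real" where
  "w_E4 b x =
     sqrt (((x - sqrt (1 - b^2)) * (x + b)) / ((1 - x^2) * (x - b) * (x + sqrt (1 - b^2))))"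

(* On E4 b one has 0 <= 1 - (cos_phi_E4 b x)^2 <= 1, so complex powr is taken at nonnegative
   reals only, where it is exp (\<mu> * ln t) for t > 0; its value 0 at t = 0 matters only on
   a null set. *)

definition moment_E4 :: "complex \<Rightarrow> nat \<Rightarrow> real \<Rightarrow> complex" where
  "moment_E4 \<mu> m b =
     (LINT x:E4 b|lborel.
        complex_of_real (cos_phi_E4 b x) ^ m
        * complex_of_real (1 - (cos_phi_E4 b x)^2) powr \<mu>
        * complex_of_real (w_E4 b x))"

definition half_range_moment :: "complex \<Rightarrow> nat \<Rightarrow> complex" where
  "half_range_moment \<mu> m =
     (LINT x:{0..1}|lborel.
        complex_of_real x ^ m * complex_of_real (1 - x^2) powr (\<mu> - 1 / 2))"

end

theory Submission
  imports Defs
begin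

text \<open>
  Put \<open>a = sqrt (1 - b^2)\<close>, so that \<open>0 < a < b\<close> and \<open>a^2 + b^2 = 1\<close>. On \<open>E4 b\<close> one has
  \<open>cos^2 \<phi> = (x^2 - a^2) (x^2 - b^2) / (a b)^2 = 1 - x^2 (1 - x^2) / (a b)^2\<close>, so the modulus
  \<open>t = |cos \<phi>|\<close> runs monotonically through \<open>(0, 1)\<close> on each of the four pieces \<open>(-1, -b)\<close>,
  \<open>(-a, 0)\<close>, \<open>(0, a)\<close>, \<open>(b, 1)\<close>. Solving for \<open>x\<close> gives \<open>x^2 = (1 + \<tau> r(t)) / 2\<close> with
  \<open>r(t) = sqrt (1 - (2 a b)^2 (1 - t^2))\<close>, where \<open>\<tau> = 1\<close> on the outer pieces and \<open>\<tau> = -1\<close> on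
  the inner ones; moreover \<open>cos \<phi> = \<tau> t\<close>.

  Substituting \<open>t\<close> for \<open>x\<close> turns the integral over each piece into the integral over \<open>(0, 1)\<close>
  of the half range density \<open>t^m (1 - t^2)^(\<mu> - 1/2)\<close> times the factor
  \<open>\<tau>^m |x - a| |x + b| / r(t)\<close> (lemma \<open>set_integral_piece\<close>). The four factors sum to \<open>2\<close> for even
  \<open>m\<close> and to \<open>2 (1 - 2 a b) / r(t)\<close> for odd \<open>m\<close> (lemma \<open>branch_factor_sum\<close>). Hence every even
  moment equals \<open>2 \<mu>^H_m\<close> for all \<open>b\<close>, and an odd moment is the half range integral against an
  explicit kernel (lemma \<open>moment_E4_eq\<close>). Since \<open>r \<ge> (b - a) (b + a)\<close> and \<open>1 - 2 a b = (b - a)^2\<close>,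
  that kernel lies between \<open>2 (1 - 2 a b)\<close> and \<open>2 (b - a)\<close>. It is therefore uniformly small as
  \<open>b \<rightarrow> 1 / sqrt 2\<close>, where \<open>a\<close> and \<open>b\<close> meet, and uniformly close to \<open>2\<close> as \<open>b \<rightarrow> 1\<close>, where
  \<open>a \<rightarrow> 0\<close>. Both limits thus come with explicit rates, \<open>2 (b - a)\<close> and \<open>4 a b\<close> times the integral
  of the modulus of the density (lemmas \<open>norm_moment_E4_odd_le\<close> and \<open>norm_moment_E4_diff_le\<close>).
  The closed form of the odd limit is the Beta-type evaluation of \<open>2 \<mu>^H_(2n+1)\<close>, obtained by
  integration by parts (lemma \<open>half_range_moment_odd\<close>).
\<close>

section \<open>Measurability and substitution for complex-valued integrands\<close>

lemma measurable_powr_complex_of_real [measurable]: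
  fixes f :: "'a \<Rightarrow> real"
  assumes [measurable]: "f \<in> borel_measurable M"
  shows "(\<lambda>x. complex_of_real (f x) powr \<nu>) \<in> borel_measurable M"
proof -
  have "(\<lambda>x. complex_of_real (f x) powr \<nu>) = (\<lambda>x. if f x = 0 then 0
      else if f x > 0 then exp (\<nu> * of_real (ln (f x)))
      else exp (\<nu> * (of_real (ln (- f x)) + \<i> * pi)))"
  proof
    fix x
    have "Ln (complex_of_real (f x)) = of_real (ln (- f x)) + \<i> * pi" if "f x < 0"
      using Ln_of_real'[of "f x"] that by (simp add: mult.commute)
    then show "complex_of_real (f x) powr \<nu> = (if f x = 0 then 0
      else if f x > 0 then exp (\<nu> * of_real (ln (f x)))
      else exp (\<nu> * (of_real (ln (- f x)) + \<i> * pi)))"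
      by (auto simp: powr_def Ln_of_real)
  qed
  also have "\<dots> \<in> borel_measurable M"
    by measurable
  finally show ?thesis .
qed

text \<open>The integrands below are singular at the ends of the intervals, hence the form of the
  change of variables theorem for absolutely integrable functions on an open set; Borel
  measurability of \<open>f\<close> carries it over from the completed measure.\<close>

lemma set_integral_substitution_lborel:
  fixes f h :: "real \<Rightarrow> complex" and g g' :: "real \<Rightarrow> real"
  assumes f [measurable]: "f \<in> borel_measurable borel"
    and S: "S \<in> sets borel" "g ` S \<in> sets borel"
    and deriv: "\<And>t. t \<in> S \<Longrightarrow> (g has_field_derivative g' t) (at t)"
    and inj: "inj_on g S"
    and h: "\<And>t. t \<in> S \<Longrightarrow> \<bar>g' t\<bar> *\<^sub>R f (g t) = h t"
    and int: "set_integrable lborel S h"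
  shows "set_integrable lborel (g ` S) f"
    and "(LINT x:g ` S|lborel. f x) = (LINT t:S|lborel. h t)"
proof -
  have "h absolutely_integrable_on S"
    using int unfolding set_integrable_def
    by (subst integrable_completion) (auto dest: borel_measurable_integrable)
  also have "h absolutely_integrable_on S \<longleftrightarrow> (\<lambda>t. \<bar>g' t\<bar> *\<^sub>R f (g t)) absolutely_integrable_on S"
    by (rule set_integrable_cong) (simp_all add: h)
  finally have "(\<lambda>t. \<bar>g' t\<bar> *\<^sub>R f (g t)) absolutely_integrable_on S" .
  moreover have "integral S (\<lambda>t. \<bar>g' t\<bar> *\<^sub>R f (g t)) = integral S h"
    by (rule integral_cong) (rule h)
  ultimately have *: "f absolutely_integrable_on g ` S" "integral (g ` S) f = integral S h"
    using has_absolute_integral_change_of_variables_real[of S g g' f "integral S h"] S deriv inj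
    by (auto intro: has_field_derivative_at_within)
  then show "set_integrable lborel (g ` S) f"
    using S unfolding set_integrable_def by (subst (asm) integrable_completion) auto
  from set_borel_integral_eq_integral(2)[OF this] set_borel_integral_eq_integral(2)[OF int] *(2)
  show "(LINT x:g ` S|lborel. f x) = (LINT t:S|lborel. h t)"
    by simp
qed

lemma set_integral_norm_le_mult:
  fixes F :: "real \<Rightarrow> complex" and c :: "real \<Rightarrow> real"
  assumes F: "set_integrable lborel S F"
    and c [measurable]: "c \<in> borel_measurable borel" and le: "\<And>t. t \<in> S \<Longrightarrow> \<bar>c t\<bar> \<le> C"
  shows "set_integrable lborel S (\<lambda>t. F t * of_real (c t))"
    and "norm (LINT t:S|lborel. F t * of_real (c t)) \<le> C * (LINT t:S|lborel. norm (F t))"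
proof -
  have bound: "norm (indicator S t *\<^sub>R (F t * of_real (c t))) \<le> C * (indicator S t *\<^sub>R norm (F t))" for t
    using mult_left_mono[OF le, of t "norm (F t)"]
    by (auto simp: indicator_def norm_mult mult.commute)
  have dom: "integrable lborel (\<lambda>t. C * (indicator S t *\<^sub>R norm (F t)))"
    using integrable_norm[OF F[unfolded set_integrable_def]] by (intro integrable_mult_right) simp
  have "(\<lambda>t. (indicator S t *\<^sub>R F t) * complex_of_real (c t)) \<in> borel_measurable lborel"
    using borel_measurable_integrable[OF F[unfolded set_integrable_def]] by measurable
  then have meas: "(\<lambda>t. indicator S t *\<^sub>R (F t * complex_of_real (c t))) \<in> borel_measurable lborel"
    by (simp only: scaleR_conv_of_real mult.assoc)
  show int: "set_integrable lborel S (\<lambda>t. F t * of_real (c t))"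
    unfolding set_integrable_def using dom meas
  proof (rule Bochner_Integration.integrable_bound)
    show "AE t in lborel. norm (indicator S t *\<^sub>R (F t * complex_of_real (c t)))
        \<le> norm (C * (indicator S t *\<^sub>R norm (F t)))"
      using bound by (intro AE_I2) (metis norm_ge_zero order_trans real_norm_def abs_ge_self)
  qed
  have "norm (LINT t:S|lborel. F t * of_real (c t)) \<le> (LINT t|lborel. C * (indicator S t *\<^sub>R norm (F t)))"
    unfolding set_lebesgue_integral_def
    by (rule Bochner_Integration.integral_norm_bound_integral[OF int[unfolded set_integrable_def] dom bound])
  then show "norm (LINT t:S|lborel. F t * of_real (c t)) \<le> C * (LINT t:S|lborel. norm (F t))"
    by (simp add: set_lebesgue_integral_def)
qed

section \<open>The ultraspherical density on the half range\<close>

definition ultra :: "complex \<Rightarrow> nat \<Rightarrow> real \<Rightarrow> complex" where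
  "ultra \<mu> m t = complex_of_real t ^ m * complex_of_real (1 - t^2) powr (\<mu> - 1 / 2)"

lemma measurable_ultra [measurable]: "ultra \<mu> m \<in> borel_measurable borel"
  unfolding ultra_def by measurable

text \<open>Near \<open>t = 1\<close> the density behaves like \<open>(1 - t)^(Re \<mu> - 1/2)\<close>, so a Beta integrand with
  second exponent \<open>Re \<mu> + 1/2 > 0\<close> dominates it; the factor \<open>(1 + t)^(Re \<mu> - 1/2)\<close> is bounded.\<close>

lemma set_integrable_ultra:
  assumes "Re \<mu> > - 1 / 2"
  shows "set_integrable lborel {0<..<1} (ultra \<mu> m)"
proof -
  define p where "p = Re \<mu> - 1 / 2"
  define C where "C = max 1 (2 powr p)"
  have "set_integrable lborel {0..1} (\<lambda>t::real. t powr (1 - 1) * (1 - t) powr ((p + 1) - 1))"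
    using assms by (intro integrable_Beta) (auto simp: p_def)
  then have "set_integrable lborel {0<..<1} (\<lambda>t::real. t powr (1 - 1) * (1 - t) powr ((p + 1) - 1))"
    by (rule set_integrable_subset) auto
  then have "set_integrable lborel {0<..<1} (\<lambda>t::real. C * (t powr (1 - 1) * (1 - t) powr ((p + 1) - 1)))"
    by (rule set_integrable_mult_right)
  then show ?thesis
  proof (rule set_integrable_bound)
    show "set_borel_measurable lborel {0<..<1} (ultra \<mu> m)"
      by (simp add: set_borel_measurable_def)
    have "norm (ultra \<mu> m t) \<le> norm (C * (t powr (1 - 1) * (1 - t) powr ((p + 1) - 1)))"
      if "0 < t" "t < 1" for t
    proof -
      have sq: "1 - t^2 = (1 - t) * (1 + t)" by (simp add: power2_eq_square algebra_simps)
      have pos: "0 < 1 - t^2" unfolding sq using that by simp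
      have "norm (complex_of_real (1 - t^2) powr (\<mu> - 1 / 2)) = (1 - t^2) powr p"
        using pos by (subst norm_powr_real_powr) (auto simp: p_def)
      also have "\<dots> = (1 - t) powr p * (1 + t) powr p"
        unfolding sq using that by (simp add: powr_mult)
      also have "(1 + t) powr p \<le> C"
      proof (cases "p \<ge> 0")
        case True
        then have "(1 + t) powr p \<le> 2 powr p" using that by (intro powr_mono2) auto
        then show ?thesis by (simp add: C_def)
      next
        case False
        then have "(1 + t) powr p \<le> 1" using that powr_mono[of p 0 "1 + t"] by simp
        then show ?thesis by (simp add: C_def)
      qed
      finally have "norm (complex_of_real (1 - t^2) powr (\<mu> - 1 / 2)) \<le> (1 - t) powr p * C"
        by (simp add: mult_left_mono)
      moreover have "t ^ m \<le> 1" using that by (simp add: power_le_one)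
      ultimately have "t ^ m * norm (complex_of_real (1 - t^2) powr (\<mu> - 1 / 2)) \<le> 1 * ((1 - t) powr p * C)"
        using that by (intro mult_mono) auto
      then show ?thesis using that
        by (simp add: ultra_def norm_mult norm_power mult.commute C_def)
    qed
    then show "AE t in lborel. t \<in> {0<..<1} \<longrightarrow> norm (ultra \<mu> m t)
        \<le> norm (C * (t powr (1 - 1) * (1 - t) powr ((p + 1) - 1)))"
      by (intro AE_I2) auto
  qed
qed

lemma half_range_moment_eq: "half_range_moment \<mu> m = (LINT t:{0<..<1}|lborel. ultra \<mu> m t)"
proof -
  have "half_range_moment \<mu> m = (LINT t:{0..1}|lborel. ultra \<mu> m t)"
    by (simp add: half_range_moment_def ultra_def)
  also have "\<dots> = (LINT t:{0<..<1}|lborel. ultra \<mu> m t)"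
  proof (rule set_integral_cong_set)
    have "AE t::real in lborel. t \<noteq> 0 \<and> t \<noteq> 1"
      by (intro AE_conjI AE_lborel_singleton)
    then show "AE t::real in lborel. (t \<in> {0<..<1}) = (t \<in> {0..1})"
      by (rule AE_mp) (rule AE_I2, auto)
  qed (unfold set_borel_measurable_def, measurable)
  finally show ?thesis .
qed

lemma has_integral_ultra:
  assumes "Re \<mu> > - 1 / 2"
  shows "(ultra \<mu> m has_integral half_range_moment \<mu> m) {0<..<1}"
proof -
  have int: "set_integrable lborel {0<..<1} (ultra \<mu> m)"
    by (rule set_integrable_ultra[OF assms])
  have "ultra \<mu> m integrable_on {0<..<1}"
    by (rule set_borel_integral_eq_integral(1)[OF int])
  then have "(ultra \<mu> m has_integral integral {0<..<1} (ultra \<mu> m)) {0<..<1}"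
    by (rule integrable_integral)
  moreover have "half_range_moment \<mu> m = integral {0<..<1} (ultra \<mu> m)"
    unfolding half_range_moment_eq by (rule set_borel_integral_eq_integral(2)[OF int])
  ultimately show ?thesis
    by (simp only:)
qed

text \<open>The derivative of \<open>t^j (1 - t^2)^(\<mu> + 1/2)\<close>, a function that vanishes at \<open>t = 1\<close> and, for
  \<open>j > 0\<close>, also at \<open>t = 0\<close>; its integral yields the recursion for the odd moments.\<close>

definition ultra_deriv :: "complex \<Rightarrow> nat \<Rightarrow> real \<Rightarrow> complex" where
  "ultra_deriv \<mu> j t = of_nat j * complex_of_real t ^ (j - 1) * complex_of_real (1 - t^2) powr (\<mu> + 1 / 2)
      - 2 * (\<mu> + 1 / 2) * ultra \<mu> (Suc j) t"

lemma has_integral_ultra_deriv: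
  assumes \<mu>: "Re \<mu> > - 1 / 2"
  shows "(ultra_deriv \<mu> j has_integral (if j = 0 then - 1 else 0)) {0<..<1}"
proof -
  define F where "F = (\<lambda>t. complex_of_real t ^ j * complex_of_real (1 - t^2) powr (\<mu> + 1 / 2))"
  have "(ultra_deriv \<mu> j has_integral F 1 - F 0) {0..1}"
  proof (rule fundamental_theorem_of_calculus_interior)
    show "continuous_on {0..1} F"
      unfolding F_def
      using \<mu> by (intro continuous_intros) (auto simp: power_le_one)
  next
    fix t :: real assume t: "t \<in> {0<..<1}"
    then have pos: "0 < 1 - t^2"
      by (simp add: power_less_one_iff)
    have nonpos: "1 - complex_of_real t ^ 2 \<notin> \<real>\<^sub>\<le>\<^sub>0"
      using pos by (metis complex_nonpos_Reals_iff Re_complex_of_real not_le of_real_1 of_real_diff of_real_power)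
    have "((\<lambda>z. z ^ j * (1 - z^2) powr (\<mu> + 1 / 2)) has_field_derivative ultra_deriv \<mu> j t)
        (at (complex_of_real t))"
      unfolding ultra_def ultra_deriv_def
      by (rule derivative_eq_intros refl nonpos | simp)+
    from has_vector_derivative_real_field[OF this]
    show "(F has_vector_derivative ultra_deriv \<mu> j t) (at t)"
      unfolding F_def by simp
  qed simp
  moreover have "F 1 - F 0 = (if j = 0 then - 1 else 0)"
    by (simp add: F_def)
  ultimately show ?thesis
    by (simp add: has_integral_Icc_iff_Ioo)
qed

text \<open>With \<open>\<nu> = \<mu> + 1/2\<close> and \<open>H n\<close> the moment of order \<open>2 n + 1\<close>, the vanishing integral of
  \<open>ultra_deriv \<mu> (2 n + 2)\<close> says \<open>(\<nu> + n + 1) H (n + 1) = (n + 1) H n\<close>, once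
  \<open>(1 - t^2)^\<nu>\<close> is split as \<open>(1 - t^2)^(\<nu> - 1) (1 - t^2)\<close>.\<close>

lemma half_range_moment_odd:
  assumes \<mu>: "Re \<mu> > - 1 / 2"
  shows "2 * half_range_moment \<mu> (2 * n + 1) = pochhammer 1 n / pochhammer (\<mu> + 1 / 2) (n + 1)"
proof (induction n)
  case 0
  have "((\<lambda>t. - 2 * (\<mu> + 1 / 2) * ultra \<mu> 1 t) has_integral - 1) {0<..<1}"
  proof -
    have "ultra_deriv \<mu> 0 = (\<lambda>t. - 2 * (\<mu> + 1 / 2) * ultra \<mu> 1 t)"
      by (simp add: fun_eq_iff ultra_deriv_def algebra_simps)
    then show ?thesis
      using has_integral_ultra_deriv[OF \<mu>, of 0] by simp
  qed
  moreover have "((\<lambda>t. - 2 * (\<mu> + 1 / 2) * ultra \<mu> 1 t) has_integral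
      - 2 * (\<mu> + 1 / 2) * half_range_moment \<mu> 1) {0<..<1}"
    by (intro has_integral_mult_right has_integral_ultra \<mu>)
  ultimately have "- 2 * (\<mu> + 1 / 2) * half_range_moment \<mu> 1 = - 1"
    by (rule has_integral_unique[rotated])
  moreover have "\<mu> + 1 / 2 \<noteq> 0"
    using \<mu> by (auto simp: complex_eq_iff)
  ultimately show ?case
    by (simp add: field_simps)
next
  case (Suc n)
  define \<nu> where "\<nu> = \<mu> + 1 / 2"
  define H where "H i = half_range_moment \<mu> (2 * i + 1)" for i
  define f where "f t = of_nat (2 * n + 2) * (ultra \<mu> (2 * n + 1) t - ultra \<mu> (2 * Suc n + 1) t)
      - 2 * \<nu> * ultra \<mu> (2 * Suc n + 1) t" for t
  have "(f has_integral 0) {0<..<1}"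
  proof (rule has_integral_eq[rotated])
    show "(ultra_deriv \<mu> (2 * n + 2) has_integral 0) {0<..<1}"
      using has_integral_ultra_deriv[OF \<mu>, of "2 * n + 2"] by simp
    fix t :: real assume "t \<in> {0<..<1}"
    then have "0 < 1 - t^2"
      by (simp add: power_less_one_iff)
    then have "complex_of_real (1 - t^2) powr (\<mu> + 1 / 2)
        = complex_of_real (1 - t^2) powr (\<mu> - 1 / 2) * complex_of_real (1 - t^2)"
      using powr_add[of "complex_of_real (1 - t^2)" "\<mu> - 1 / 2" 1] by (simp add: add.commute del: of_real_diff)
    then have "ultra_deriv \<mu> (2 * n + 2) t = of_nat (2 * n + 2) * complex_of_real t ^ (2 * n + 1)
         * (complex_of_real (1 - t^2) powr (\<mu> - 1 / 2) * complex_of_real (1 - t^2))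
         - 2 * \<nu> * ultra \<mu> (2 * Suc n + 1) t"
      by (simp add: ultra_deriv_def \<nu>_def)
    also have "\<dots> = f t"
      by (simp add: f_def ultra_def algebra_simps power2_eq_square)
    finally show "ultra_deriv \<mu> (2 * n + 2) t = f t" .
  qed
  moreover have "(f has_integral of_nat (2 * n + 2) * (H n - H (Suc n)) - 2 * \<nu> * H (Suc n)) {0<..<1}"
    unfolding f_def H_def
    by (intro has_integral_diff has_integral_mult_right has_integral_ultra \<mu>)
  ultimately have "of_nat (2 * n + 2) * (H n - H (Suc n)) - 2 * \<nu> * H (Suc n) = 0"
    by (rule has_integral_unique[rotated])
  then have "2 * ((\<nu> + of_nat (Suc n)) * H (Suc n)) = 2 * (of_nat (Suc n) * H n)"
    by (simp add: algebra_simps)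
  then have rec: "(\<nu> + of_nat (Suc n)) * H (Suc n) = of_nat (Suc n) * H n"
    by (simp only: mult_cancel_left) simp
  have nz: "\<nu> + of_nat (Suc n) \<noteq> 0"
    using \<mu> by (auto simp: complex_eq_iff \<nu>_def)
  have "H (Suc n) = of_nat (Suc n) * H n / (\<nu> + of_nat (Suc n))"
    using nz rec by (metis eq_divide_imp mult.commute)
  then have "2 * H (Suc n) = of_nat (Suc n) * (2 * H n) / (\<nu> + of_nat (Suc n))"
    by simp
  also have "\<dots> = pochhammer 1 (Suc n) / pochhammer \<nu> (Suc n + 1)"
    using Suc.IH unfolding \<nu>_def[symmetric] H_def[symmetric]
    by (simp add: pochhammer_Suc mult_ac add_ac)
  finally show ?case
    by (simp add: \<nu>_def H_def)
qed

section \<open>Parametrisation of the three intervals by the modulus of the cosine\<close>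

locale three_intervals =
  fixes a b :: real
  assumes a_pos: "0 < a" and a_less_b: "a < b" and unit_circle: "a^2 + b^2 = 1"
begin

text \<open>In the parametrisation \<open>x = sin \<theta>\<close>, where \<open>|sin (2 \<theta>)| = 2 a b sqrt (1 - t^2)\<close>, this is
  \<open>|cos (2 \<theta>)|\<close>, that is \<open>|1 - 2 x^2|\<close>.\<close>

definition gap :: "real \<Rightarrow> real" where
  "gap t = sqrt (1 - 4 * a^2 * b^2 * (1 - t^2))"

text \<open>The four inverses of \<open>|cos \<phi>|\<close>: the sign \<open>\<sigma>\<close> is that of \<open>x\<close>, while \<open>\<tau>\<close> is \<open>1\<close> on the two
  outer intervals and \<open>-1\<close> on the inner one.\<close>

definition branch :: "real \<Rightarrow> real \<Rightarrow> real \<Rightarrow> real" where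
  "branch \<tau> \<sigma> t = \<sigma> * sqrt ((1 + \<tau> * gap t) / 2)"

definition branch_factor :: "real \<Rightarrow> real \<Rightarrow> real \<Rightarrow> real" where
  "branch_factor \<tau> \<sigma> t = \<tau> * (branch \<tau> \<sigma> t - a) * (branch \<tau> \<sigma> t + b)"

definition branch_deriv :: "real \<Rightarrow> real \<Rightarrow> real \<Rightarrow> real" where
  "branch_deriv \<tau> \<sigma> t = \<tau> * a^2 * b^2 * t / (gap t * branch \<tau> \<sigma> t)"

definition piece :: "real \<Rightarrow> real \<Rightarrow> real set" where
  "piece \<tau> \<sigma> = {x. 0 < \<sigma> * x \<and> (if \<tau> = 1 then b < \<bar>x\<bar> \<and> \<bar>x\<bar> < 1 else \<bar>x\<bar> < a)}"

lemma b_pos: "0 < b" and b_less_1: "b < 1" and sqrt_b: "sqrt (1 - b^2) = a" and sq_less: "a^2 < b^2"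
proof -
  show "0 < b" using a_pos a_less_b by simp
  have "b^2 < 1" using unit_circle a_pos by (smt (verit) zero_less_power)
  then show "b < 1" by (simp add: power_less_one_iff abs_square_less_1)
  have "1 - b^2 = a^2" using unit_circle by simp
  then show "sqrt (1 - b^2) = a" using a_pos by simp
  show "a^2 < b^2" using a_pos a_less_b by (simp add: power_strict_mono)
qed

lemma two_ab_less_1: "2 * a * b < 1"
proof -
  have "0 < (b - a)^2" using a_less_b by simp
  then show ?thesis using unit_circle by (simp add: power2_diff mult_ac)
qed

lemma four_ab_sq: "4 * a^2 * b^2 = 1 - (b^2 - a^2)^2"
proof -
  have "(a^2 + b^2)^2 = 1" using unit_circle by simp
  then show ?thesis by (simp add: power2_eq_square algebra_simps)
qed

lemma gap_bounds:
  assumes "0 < t" "t < 1"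
  shows "(gap t)^2 = 1 - 4 * a^2 * b^2 * (1 - t^2)" "b^2 - a^2 < gap t" "gap t < 1" "0 < gap t"
proof -
  have t: "0 < t^2" "t^2 < 1" using assms by (auto simp: power_less_one_iff)
  have k: "0 < 4 * a^2 * b^2" using a_pos b_pos by simp
  have lt: "(b^2 - a^2)^2 < 1 - 4 * a^2 * b^2 * (1 - t^2)"
    using mult_strict_left_mono[OF t(1) k] unfolding four_ab_sq by (simp add: algebra_simps)
  have gt: "1 - 4 * a^2 * b^2 * (1 - t^2) < 1"
    using mult_pos_pos[OF k, of "1 - t^2"] t by simp
  have nn: "0 \<le> 1 - 4 * a^2 * b^2 * (1 - t^2)"
    using lt zero_le_power2[of "b^2 - a^2"] by linarith
  then show "(gap t)^2 = 1 - 4 * a^2 * b^2 * (1 - t^2)"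
    unfolding gap_def by (rule real_sqrt_pow2)
  show "b^2 - a^2 < gap t" unfolding gap_def using lt by (rule real_less_rsqrt)
  then show "0 < gap t" using sq_less by simp
  show "gap t < 1" unfolding gap_def using gt by simp
qed

context
  fixes \<tau> \<sigma> :: real
  assumes \<tau>: "\<tau> \<in> {1, - 1}" and \<sigma>: "\<sigma> \<in> {1, - 1}"
begin

lemma branch_sq:
  assumes t: "0 < t" "t < 1"
  shows "(branch \<tau> \<sigma> t)^2 = (1 + \<tau> * gap t) / 2"
proof -
  have "0 \<le> (1 + \<tau> * gap t) / 2" using gap_bounds[OF t] \<tau> by auto
  then show ?thesis using \<sigma> by (auto simp: branch_def power_mult_distrib)
qed

text \<open>For surjectivity, the parameter belonging to \<open>x\<close> comes from solving
  \<open>r = \<tau> (2 x^2 - 1)\<close>, \<open>r^2 = 1 - (2 a b)^2 (1 - t^2)\<close> for \<open>t\<close>; the bounds that make it an element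
  of \<open>(0, 1)\<close> are \<open>b^2 - a^2 < r < 1\<close>, because \<open>(b^2 - a^2)^2 = 1 - (2 a b)^2\<close>.\<close>

lemma branch_image: "branch \<tau> \<sigma> ` {0<..<1} = piece \<tau> \<sigma>"
proof (intro equalityI subsetI)
  fix x assume "x \<in> branch \<tau> \<sigma> ` {0<..<1}"
  then obtain t where t: "0 < t" "t < 1" and x: "x = branch \<tau> \<sigma> t" by auto
  note g = gap_bounds[OF t]
  have sq: "x^2 = (1 + \<tau> * gap t) / 2" using branch_sq[OF t] x by simp
  have "0 < (1 + \<tau> * gap t) / 2" using g \<tau> by auto
  then have pos: "0 < \<sigma> * x" using \<sigma> by (auto simp: x branch_def)
  show "x \<in> piece \<tau> \<sigma>"
  proof (cases "\<tau> = 1")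
    case True
    then have "b^2 < x^2" "x^2 < 1" using sq g unit_circle by auto
    then have "b < \<bar>x\<bar>" "\<bar>x\<bar> < 1"
      using b_pos by (auto simp: abs_square_less_1 intro: power2_less_imp_less[of b "\<bar>x\<bar>"])
    then show ?thesis using pos True by (simp add: piece_def)
  next
    case False
    then have "x^2 < a^2" using sq g unit_circle \<tau> by auto
    then have "\<bar>x\<bar> < a" using a_pos by (intro power2_less_imp_less[of "\<bar>x\<bar>" a]) auto
    then show ?thesis using pos False by (simp add: piece_def)
  qed
next
  fix x assume x: "x \<in> piece \<tau> \<sigma>"
  define r where "r = \<tau> * (2 * x^2 - 1)"
  have "x \<noteq> 0" using x by (auto simp: piece_def)
  have r: "b^2 - a^2 < r" "r < 1"
  proof -
    consider "\<tau> = 1" "b^2 < x^2" "x^2 < 1" | "\<tau> = - 1" "x^2 < a^2"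
    proof (cases "\<tau> = 1")
      case True
      then have "b < \<bar>x\<bar>" "\<bar>x\<bar> < 1" using x by (auto simp: piece_def)
      then show ?thesis using that(1) True b_pos power_strict_mono[of b "\<bar>x\<bar>" 2]
        by (simp add: abs_square_less_1)
    next
      case False
      then have "\<bar>x\<bar> < a" using x by (auto simp: piece_def)
      then show ?thesis using that(2) False \<tau> power_strict_mono[of "\<bar>x\<bar>" a 2] by simp
    qed
    then have "b^2 - a^2 < r \<and> r < 1"
    proof cases
      case 1 then show ?thesis using unit_circle by (simp add: r_def)
    next
      case 2
      have "0 < x^2" using \<open>x \<noteq> 0\<close> by simp
      with 2 show ?thesis using unit_circle by (simp add: r_def)
    qed
    then show "b^2 - a^2 < r" "r < 1" by auto
  qed
  define s where "s = (1 - r^2) / (4 * a^2 * b^2)"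
  define t where "t = sqrt (1 - s)"
  have k: "0 < 4 * a^2 * b^2" using a_pos b_pos by simp
  have "(b^2 - a^2)^2 < r^2" using r sq_less by (intro power_strict_mono) auto
  then have "s < 1" using k four_ab_sq by (simp add: s_def divide_less_eq)
  moreover have "r^2 < 1" using r sq_less by (simp add: abs_square_less_1)
  then have "0 < s" using k unfolding s_def by (intro divide_pos_pos) auto
  ultimately have t: "0 < t" "t < 1" and t2: "1 - t^2 = s" by (auto simp: t_def)
  have "1 - 4 * a^2 * b^2 * (1 - t^2) = r^2" using a_pos b_pos by (simp add: t2 s_def)
  then have "gap t = r" using r sq_less by (simp add: gap_def)
  then have "(1 + \<tau> * gap t) / 2 = x^2" using \<tau> by (auto simp: r_def)
  then have "branch \<tau> \<sigma> t = \<sigma> * \<bar>x\<bar>" by (simp add: branch_def)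
  also have "\<dots> = x" using x \<sigma> by (auto simp: piece_def)
  finally show "x \<in> branch \<tau> \<sigma> ` {0<..<1}" using t by force
qed

lemma inj_on_branch: "inj_on (branch \<tau> \<sigma>) {0<..<1}"
proof (rule inj_onI)
  fix s t assume s: "s \<in> {0<..<1}" and t: "t \<in> {0<..<1}" and "branch \<tau> \<sigma> s = branch \<tau> \<sigma> t"
  then have "(1 + \<tau> * gap s) / 2 = (1 + \<tau> * gap t) / 2"
    using branch_sq[of s] branch_sq[of t] by auto
  then have "gap s = gap t" using \<tau> by auto
  then have "1 - 4 * a^2 * b^2 * (1 - s^2) = 1 - 4 * a^2 * b^2 * (1 - t^2)"
    using gap_bounds(1)[of s] gap_bounds(1)[of t] s t by auto
  then have "s^2 = t^2" using a_pos b_pos by simp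
  then show "s = t" using s t by (simp add: power2_eq_iff_nonneg)
qed

lemma branch_has_derivative:
  assumes t: "0 < t" "t < 1"
  shows "(branch \<tau> \<sigma> has_field_derivative branch_deriv \<tau> \<sigma> t) (at t)"
proof -
  note g = gap_bounds[OF t]
  have "0 < 1 - 4 * a^2 * b^2 * (1 - t^2)" using g by (metis zero_less_power)
  then have dg: "(gap has_field_derivative 4 * a^2 * b^2 * t / gap t) (at t)"
    unfolding gap_def[abs_def]
    by (auto intro!: derivative_eq_intros simp: field_simps)
  have pos: "0 < (1 + \<tau> * gap t) / 2" using g \<tau> by auto
  define R where "R = sqrt ((1 + \<tau> * gap t) / 2)"
  have R: "0 < R" using pos by (simp add: R_def)
  have "(branch \<tau> \<sigma> has_field_derivative \<sigma> * (\<tau> * (4 * a^2 * b^2 * t / gap t) / 2 * (inverse R / 2))) (at t)"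
    unfolding branch_def[abs_def] R_def using pos
    by (auto intro!: derivative_eq_intros dg simp: field_simps)
  also have "\<sigma> * (\<tau> * (4 * a^2 * b^2 * t / gap t) / 2 * (inverse R / 2)) = branch_deriv \<tau> \<sigma> t"
    using \<sigma> R g(4) by (auto simp: branch_deriv_def branch_def R_def[symmetric] field_simps)
  finally show ?thesis .
qed

text \<open>With \<open>X = (u - a) (u + b)\<close> and \<open>Y = (u + a) (u - b)\<close>, both of sign \<open>\<tau>\<close>, everything follows
  from \<open>X Y = (a b t)^2\<close>: the radical \<open>sqrt (X / Y)\<close> is \<open>a b t / |Y|\<close>, hence \<open>cos \<phi> = \<tau> t\<close>, and
  the Jacobian cancels \<open>Y\<close> in the weight because \<open>|u| sqrt (1 - u^2) = a b sqrt (1 - t^2)\<close>.\<close>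

lemma branch_values:
  assumes t: "0 < t" "t < 1"
  defines "u \<equiv> branch \<tau> \<sigma> t"
  shows "cos_phi_E4 b u = \<tau> * t"
    and "\<bar>branch_deriv \<tau> \<sigma> t\<bar> * w_E4 b u = branch_factor \<tau> \<sigma> t / (gap t * sqrt (1 - t^2))"
    and "0 < branch_factor \<tau> \<sigma> t" and "branch_factor \<tau> \<sigma> t \<le> 4"
proof -
  note g = gap_bounds[OF t]
  have u2: "u^2 = (1 + \<tau> * gap t) / 2" unfolding u_def by (rule branch_sq[OF t])
  have u_piece: "u \<in> piece \<tau> \<sigma>" using branch_image t by (auto simp: u_def)
  have \<tau>2: "\<tau> * \<tau> = 1" using \<tau> by auto
  define X where "X = (u - a) * (u + b)"
  define Y where "Y = (u + a) * (u - b)"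
  have signs: "0 < \<tau> * X \<and> 0 < \<tau> * Y \<and> \<bar>u\<bar> < 1"
  proof (cases "\<tau> = 1")
    case True
    then have "b < \<bar>u\<bar>" "\<bar>u\<bar> < 1" using u_piece by (auto simp: piece_def)
    then show ?thesis using True a_pos a_less_b
      by (cases "u > 0") (auto simp: X_def Y_def intro: mult_pos_pos mult_neg_neg)
  next
    case False
    then have "\<bar>u\<bar> < a" using u_piece by (auto simp: piece_def)
    then have "X < 0" "Y < 0" "\<bar>u\<bar> < 1" using a_less_b b_less_1
      by (auto simp: X_def Y_def intro: mult_neg_pos mult_pos_neg)
    then show ?thesis using False \<tau> by auto
  qed
  have absX: "\<bar>X\<bar> = \<tau> * X" and absY: "\<bar>Y\<bar> = \<tau> * Y" using signs \<tau> by auto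
  have Xf: "branch_factor \<tau> \<sigma> t = \<bar>X\<bar>" 
    unfolding absX by (simp add: branch_factor_def X_def u_def mult.assoc)
  show "0 < branch_factor \<tau> \<sigma> t" using signs by (simp add: Xf absX)
  have "\<bar>X\<bar> \<le> 2 * 2" unfolding X_def abs_mult using signs a_pos a_less_b b_less_1
    by (intro mult_mono) auto
  then show "branch_factor \<tau> \<sigma> t \<le> 4" by (simp add: Xf)
  have u4: "u^2 * (1 - u^2) = a^2 * b^2 * (1 - t^2)"
  proof -
    have "u^2 * (1 - u^2) = (1 - (\<tau> * \<tau>) * (gap t)^2) / 4"
      unfolding u2 by (simp add: field_simps power2_eq_square)
    then show ?thesis unfolding \<tau>2 g(1) by simp
  qed
  have XY: "X * Y = (a * b * t)^2"
  proof -
    have "X * Y = a^2 * b^2 - u^2 * (a^2 + b^2) + (u^2)^2"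
      by (simp add: X_def Y_def power2_eq_square algebra_simps)
    also have "\<dots> = a^2 * b^2 - u^2 * (1 - u^2)"
      unfolding unit_circle by (simp add: power2_eq_square algebra_simps)
    finally show ?thesis unfolding u4 by (simp add: power_mult_distrib algebra_simps)
  qed
  have nz: "X \<noteq> 0" "Y \<noteq> 0" using signs by auto
  have abt: "0 < a * b * t" using a_pos b_pos t by simp
  have ratio: "sqrt (X / Y) = a * b * t / \<bar>Y\<bar>"
  proof -
    have "X / Y = (a * b * t / Y)^2" using XY nz by (simp add: power_divide field_simps power2_eq_square)
    then show ?thesis using abt by (simp add: real_sqrt_abs)
  qed
  have "cos_phi_E4 b u = sqrt (X / Y) * (Y / (b * a))"
    by (simp add: cos_phi_E4_def sqrt_b X_def Y_def mult_ac)
  also have "\<dots> = \<tau> * t" unfolding ratio absY using nz a_pos b_pos \<tau> by auto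
  finally show "cos_phi_E4 b u = \<tau> * t" .
  have u1: "0 < 1 - u^2" using signs by (simp add: abs_square_less_1)
  have u0: "u \<noteq> 0" using u_piece by (auto simp: piece_def)
  have w: "w_E4 b u = a * b * t / (\<bar>Y\<bar> * sqrt (1 - u^2))"
  proof -
    have "w_E4 b u = sqrt ((X / Y) / (1 - u^2))"
      by (simp add: w_E4_def sqrt_b X_def Y_def mult_ac)
    then show ?thesis unfolding real_sqrt_divide[of "X / Y"] ratio by simp
  qed
  have root: "\<bar>u\<bar> * sqrt (1 - u^2) = a * b * sqrt (1 - t^2)"
  proof -
    have "\<bar>u\<bar> * sqrt (1 - u^2) = sqrt (u^2 * (1 - u^2))" by (simp add: real_sqrt_mult)
    also have "\<dots> = a * b * sqrt (1 - t^2)"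
      unfolding u4 using a_pos b_pos by (simp add: real_sqrt_mult)
    finally show ?thesis .
  qed
  have "\<bar>branch_deriv \<tau> \<sigma> t\<bar> = a^2 * b^2 * t / (gap t * \<bar>u\<bar>)"
    using \<tau> t g(4) by (auto simp: branch_deriv_def u_def abs_mult)
  then have "\<bar>branch_deriv \<tau> \<sigma> t\<bar> * w_E4 b u
      = a * b * (a * b * t)^2 / (gap t * \<bar>Y\<bar> * (\<bar>u\<bar> * sqrt (1 - u^2)))"
    unfolding w by (simp add: power2_eq_square mult_ac)
  also have "(a * b * t)^2 = \<bar>X\<bar> * \<bar>Y\<bar>"
    using XY by (metis abs_mult abs_power2)
  finally show "\<bar>branch_deriv \<tau> \<sigma> t\<bar> * w_E4 b u = branch_factor \<tau> \<sigma> t / (gap t * sqrt (1 - t^2))"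
    unfolding root Xf using nz a_pos b_pos by simp
qed

end

text \<open>The terms linear in \<open>x\<close> cancel between \<open>\<sigma> = 1\<close> and \<open>\<sigma> = -1\<close>, which leaves
  \<open>r + \<tau> (1 - 2 a b)\<close>; the sum over \<open>\<tau>\<close> with the sign \<open>\<tau>^m\<close> then keeps one of the two terms,
  according to the parity of \<open>m\<close>.\<close>

lemma branch_factor_sum:
  assumes t: "0 < t" "t < 1"
  shows "(\<Sum>(\<tau>, \<sigma>)\<in>{1, -1} \<times> {1, -1}. \<tau> ^ m * branch_factor \<tau> \<sigma> t / gap t)
    = (if even m then 2 else 2 * (1 - 2 * a * b) / gap t)"
proof -
  note g = gap_bounds[OF t]
  have pair: "branch_factor \<tau> 1 t + branch_factor \<tau> (- 1) t = gap t + \<tau> * (1 - 2 * a * b)"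
    if "\<tau> \<in> {1, - 1}" for \<tau>
  proof -
    have "branch \<tau> (- 1) t = - branch \<tau> 1 t" by (simp add: branch_def)
    then have "branch_factor \<tau> 1 t + branch_factor \<tau> (- 1) t = \<tau> * (2 * (branch \<tau> 1 t)^2 - 2 * a * b)"
      by (simp add: branch_factor_def power2_eq_square algebra_simps)
    also have "\<dots> = \<tau> * \<tau> * gap t + \<tau> * (1 - 2 * a * b)"
      using that t by (subst branch_sq) (auto simp: algebra_simps)
    finally show ?thesis using that by auto
  qed
  have "(\<Sum>(\<tau>, \<sigma>)\<in>{1, -1} \<times> {1, -1}. \<tau> ^ m * branch_factor \<tau> \<sigma> t / gap t)
    = ((branch_factor 1 1 t + branch_factor 1 (-1) t)
       + (-1) ^ m * (branch_factor (-1) 1 t + branch_factor (-1) (-1) t)) / gap t"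
    by (simp add: sum.cartesian_product[symmetric] add_divide_distrib algebra_simps)
  also have "\<dots> = (if even m then 2 else 2 * (1 - 2 * a * b) / gap t)"
    using g(4) by (simp add: pair add_divide_distrib diff_divide_distrib)
  finally show ?thesis .
qed

lemma pieces:
  "piece 1 1 = {b<..<1}" "piece 1 (- 1) = {- 1<..<- b}"
  "piece (- 1) 1 = {0<..<a}" "piece (- 1) (- 1) = {- a<..<0}"
  using b_pos by (auto simp: piece_def)

lemma AE_E4_iff_pieces:
  "AE x in lborel. x \<in> (\<Union>(\<tau>, \<sigma>)\<in>{1, -1} \<times> {1, -1}. piece \<tau> \<sigma>) \<longleftrightarrow> x \<in> E4 b"
proof -
  have union: "(\<Union>(\<tau>, \<sigma>)\<in>{1, -1} \<times> {1, -1}. piece \<tau> \<sigma>)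
      = ({b<..<1} \<union> {- 1<..<- b}) \<union> ({0<..<a} \<union> {- a<..<0})"
    by (simp add: pieces Sigma_def Un_ac)
  have "finite {0, 1, - 1, a, - a, b, - b}" by simp
  then have "AE x in lborel. x \<notin> {0, 1, - 1, a, - a, b, - b}"
    by (intro AE_not_in finite_imp_null_set_lborel)
  then show ?thesis
  proof eventually_elim
    case (elim x)
    then show ?case
      using a_pos unfolding union E4_def sqrt_b Un_iff greaterThanLessThan_iff atLeastAtMost_iff
      by (simp add: less_le) linarith
  qed
qed

end

section \<open>The moments as half range integrals\<close>

definition moment_integrand :: "complex \<Rightarrow> nat \<Rightarrow> real \<Rightarrow> real \<Rightarrow> complex" where
  "moment_integrand \<mu> m b x = complex_of_real (cos_phi_E4 b x) ^ m
    * complex_of_real (1 - (cos_phi_E4 b x)^2) powr \<mu> * complex_of_real (w_E4 b x)"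

lemma measurable_moment_integrand [measurable]: "moment_integrand \<mu> m b \<in> borel_measurable borel"
  unfolding moment_integrand_def cos_phi_E4_def w_E4_def by measurable

context three_intervals
begin

lemma measurable_branch [measurable]:
  "gap \<in> borel_measurable borel" "branch \<tau> \<sigma> \<in> borel_measurable borel"
  "branch_factor \<tau> \<sigma> \<in> borel_measurable borel" "piece \<tau> \<sigma> \<in> sets borel"
proof -
  show gap [measurable]: "gap \<in> borel_measurable borel"
    unfolding gap_def by measurable
  show branch [measurable]: "branch \<tau> \<sigma> \<in> borel_measurable borel"
    unfolding branch_def by measurable
  show "branch_factor \<tau> \<sigma> \<in> borel_measurable borel"
    unfolding branch_factor_def by measurable
  show "piece \<tau> \<sigma> \<in> sets borel"
    unfolding piece_def by measurable
qed

text \<open>The exponent drops from \<open>\<mu>\<close> to \<open>\<mu> - 1/2\<close> because the weight times the Jacobian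
  contributes \<open>1 / sqrt (1 - t^2)\<close>.\<close>

lemma moment_integrand_branch:
  assumes \<tau>: "\<tau> \<in> {1, - 1}" and \<sigma>: "\<sigma> \<in> {1, - 1}" and t: "0 < t" "t < 1"
  shows "\<bar>branch_deriv \<tau> \<sigma> t\<bar> *\<^sub>R moment_integrand \<mu> m b (branch \<tau> \<sigma> t)
    = ultra \<mu> m t * of_real (\<tau> ^ m * branch_factor \<tau> \<sigma> t / gap t)"
proof -
  note v = branch_values[OF \<tau> \<sigma> t]
  have pos: "0 < 1 - t^2" using t by (simp add: power_less_one_iff)
  have "complex_of_real (1 - t^2) powr (1 / 2) = of_real (sqrt (1 - t^2))"
    using pos by (simp add: powr_half_sqrt[symmetric] powr_of_real[symmetric] del: of_real_diff)
  then have half: "complex_of_real (1 - t^2) powr \<mu> / of_real (sqrt (1 - t^2)) = complex_of_real (1 - t^2) powr (\<mu> - 1 / 2)"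
    using powr_diff[of "complex_of_real (1 - t^2)" \<mu> "1/2"] by (simp del: of_real_diff)
  have sq: "(\<tau> * t)^2 = t^2" using \<tau> by auto
  have "\<bar>branch_deriv \<tau> \<sigma> t\<bar> *\<^sub>R moment_integrand \<mu> m b (branch \<tau> \<sigma> t)
    = complex_of_real (\<tau> * t) ^ m * complex_of_real (1 - t^2) powr \<mu>
      * complex_of_real (\<bar>branch_deriv \<tau> \<sigma> t\<bar> * w_E4 b (branch \<tau> \<sigma> t))"
    unfolding moment_integrand_def v(1) sq by (simp add: scaleR_conv_of_real mult_ac)
  also have "\<dots> = complex_of_real (\<tau> * t) ^ m
      * (complex_of_real (1 - t^2) powr \<mu> / of_real (sqrt (1 - t^2)))
      * complex_of_real (branch_factor \<tau> \<sigma> t / gap t)"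
    unfolding v(2) by simp
  also have "\<dots> = ultra \<mu> m t * of_real (\<tau> ^ m * branch_factor \<tau> \<sigma> t / gap t)"
    unfolding half by (simp add: ultra_def power_mult_distrib)
  finally show ?thesis .
qed

text \<open>Each piece is integrable separately, so that the integral over \<open>E4 b\<close> splits: its factor is
  bounded since \<open>r\<close> stays above \<open>b^2 - a^2 > 0\<close>.\<close>

lemma set_integral_piece:
  fixes m :: nat
  assumes \<mu>: "Re \<mu> > - 1 / 2" and \<tau>: "\<tau> \<in> {1, - 1}" and \<sigma>: "\<sigma> \<in> {1, - 1}"
  defines "h \<equiv> \<lambda>t. ultra \<mu> m t * of_real (\<tau> ^ m * branch_factor \<tau> \<sigma> t / gap t)"
  shows "set_integrable lborel {0<..<1} h"
    and "set_integrable lborel (piece \<tau> \<sigma>) (moment_integrand \<mu> m b)"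
    and "(LINT x:piece \<tau> \<sigma>|lborel. moment_integrand \<mu> m b x) = (LINT t:{0<..<1}|lborel. h t)"
proof -
  show int: "set_integrable lborel {0<..<1} h"
    unfolding h_def
  proof (rule set_integral_norm_le_mult(1)[OF set_integrable_ultra[OF \<mu>]])
    fix t :: real assume "t \<in> {0<..<1}"
    then have t: "0 < t" "t < 1" by auto
    have "\<bar>\<tau> ^ m * branch_factor \<tau> \<sigma> t / gap t\<bar> = branch_factor \<tau> \<sigma> t / gap t"
      using \<tau> branch_values(3)[OF \<tau> \<sigma> t] gap_bounds(4)[OF t] by (auto simp: abs_mult power_abs)
    also have "\<dots> \<le> 4 / (b^2 - a^2)"
      using branch_values(3,4)[OF \<tau> \<sigma> t] gap_bounds(2)[OF t] sq_less by (intro frac_le) auto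
    finally show "\<bar>\<tau> ^ m * branch_factor \<tau> \<sigma> t / gap t\<bar> \<le> 4 / (b^2 - a^2)" .
  qed measurable
  note subst = set_integral_substitution_lborel[where f = "moment_integrand \<mu> m b" and h = h
      and S = "{0<..<1}" and g = "branch \<tau> \<sigma>" and g' = "branch_deriv \<tau> \<sigma>",
      unfolded branch_image[OF \<tau> \<sigma>], OF _ _ _ _ inj_on_branch[OF \<tau> \<sigma>] _ int]
  show "set_integrable lborel (piece \<tau> \<sigma>) (moment_integrand \<mu> m b)"
    by (rule subst)
      (use branch_has_derivative[OF \<tau> \<sigma>] moment_integrand_branch[OF \<tau> \<sigma>] in \<open>auto simp: h_def\<close>)
  show "(LINT x:piece \<tau> \<sigma>|lborel. moment_integrand \<mu> m b x) = (LINT t:{0<..<1}|lborel. h t)"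
    by (rule subst)
      (use branch_has_derivative[OF \<tau> \<sigma>] moment_integrand_branch[OF \<tau> \<sigma>] in \<open>auto simp: h_def\<close>)
qed

lemma moment_E4_eq:
  assumes \<mu>: "Re \<mu> > - 1 / 2"
  shows "moment_E4 \<mu> m b = (LINT t:{0<..<1}|lborel.
    ultra \<mu> m t * of_real (if even m then 2 else 2 * (1 - 2 * a * b) / gap t))"
proof -
  let ?I = "{1, -1} \<times> {1, -1} :: (real \<times> real) set"
  let ?P = "\<lambda>(\<tau>, \<sigma>). piece \<tau> \<sigma>"
  let ?h = "\<lambda>(\<tau>, \<sigma>) t. ultra \<mu> m t * of_real (\<tau> ^ m * branch_factor \<tau> \<sigma> t / gap t)"
  have "moment_E4 \<mu> m b = (LINT x:E4 b|lborel. moment_integrand \<mu> m b x)"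
    by (simp add: moment_E4_def moment_integrand_def)
  also have "\<dots> = (LINT x:(\<Union>i\<in>?I. ?P i)|lborel. moment_integrand \<mu> m b x)"
  proof (rule set_integral_cong_set)
    have [measurable]: "(\<Union>i\<in>?I. ?P i) \<in> sets borel"
      by (intro sets.finite_UN) (auto simp: case_prod_beta)
    show "set_borel_measurable lborel (\<Union>i\<in>?I. ?P i) (moment_integrand \<mu> m b)"
      unfolding set_borel_measurable_def by measurable
    have [measurable]: "E4 b \<in> sets borel"
      unfolding E4_def by simp
    show "set_borel_measurable lborel (E4 b) (moment_integrand \<mu> m b)"
      unfolding set_borel_measurable_def by measurable
  qed (rule AE_E4_iff_pieces)
  also have "\<dots> = (\<Sum>i\<in>?I. LINT x:?P i|lborel. moment_integrand \<mu> m b x)"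
  proof (rule set_integral_finite_Union)
    show "disjoint_family_on ?P ?I"
      unfolding disjoint_family_on_def using a_less_b a_pos b_less_1 by (simp add: pieces)
  qed (use set_integral_piece(2)[OF \<mu>] in \<open>auto simp: case_prod_beta\<close>)
  also have "\<dots> = (\<Sum>i\<in>?I. LINT t:{0<..<1}|lborel. ?h i t)"
    by (rule sum.cong) (use set_integral_piece(3)[OF \<mu>] in auto)
  also have "\<dots> = (LINT t:{0<..<1}|lborel. (\<Sum>i\<in>?I. ?h i t))"
    unfolding set_lebesgue_integral_def scaleR_sum_right
    by (rule Bochner_Integration.integral_sum[symmetric])
      (use set_integral_piece(1)[OF \<mu>] in \<open>auto simp: set_integrable_def\<close>)
  also have "\<dots> = (LINT t:{0<..<1}|lborel.
    ultra \<mu> m t * of_real (if even m then 2 else 2 * (1 - 2 * a * b) / gap t))"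
  proof (rule set_lebesgue_integral_cong)
    show "\<forall>t. t \<in> {0<..<1} \<longrightarrow> (\<Sum>i\<in>?I. ?h i t)
        = ultra \<mu> m t * of_real (if even m then 2 else 2 * (1 - 2 * a * b) / gap t)"
    proof (intro allI impI)
      fix t :: real assume "t \<in> {0<..<1}"
      then have t: "0 < t" "t < 1" by auto
      have "(\<Sum>i\<in>?I. ?h i t) = ultra \<mu> m t * of_real (\<Sum>(\<tau>, \<sigma>)\<in>?I. \<tau> ^ m * branch_factor \<tau> \<sigma> t / gap t)"
        unfolding of_real_sum sum_distrib_left by (simp only: case_prod_beta)
      then show "(\<Sum>i\<in>?I. ?h i t)
        = ultra \<mu> m t * of_real (if even m then 2 else 2 * (1 - 2 * a * b) / gap t)"
        unfolding branch_factor_sum[OF t] .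
    qed
  qed simp
  finally show ?thesis .
qed

section \<open>Uniform estimates and the limits\<close>

text \<open>The upper bound uses \<open>1 - 2 a b = (b - a)^2\<close> and \<open>r \<ge> (b - a) (b + a) \<ge> b - a\<close>, where
  \<open>a + b \<ge> 1\<close> because \<open>(a + b)^2 = 1 + 2 a b\<close>; the lower one is just \<open>r \<le> 1\<close>.\<close>

lemma odd_kernel_bounds:
  assumes t: "0 < t" "t < 1"
  shows "2 * (1 - 2 * a * b) / gap t \<le> 2 * (b - a)"
    and "2 * (1 - 2 * a * b) \<le> 2 * (1 - 2 * a * b) / gap t"
proof -
  note g = gap_bounds[OF t]
  have k: "1 - 2 * a * b = (b - a)^2"
    using unit_circle by (simp add: power2_diff)
  have "1 \<le> a + b"
  proof (rule power2_le_imp_le)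
    show "1^2 \<le> (a + b)^2"
      using unit_circle a_pos b_pos by (simp add: power2_sum)
  qed (use a_pos b_pos in simp)
  then have "(b - a) * 1 \<le> (b - a) * (a + b)"
    using a_less_b by (intro mult_left_mono) auto
  then have "b - a \<le> gap t"
    using g(2) by (simp add: power2_eq_square algebra_simps)
  then have "(b - a) * (b - a) \<le> (b - a) * gap t"
    using a_less_b by (intro mult_left_mono) auto
  then show "2 * (1 - 2 * a * b) / gap t \<le> 2 * (b - a)"
    unfolding k using g(4) by (simp add: power2_eq_square field_simps)
  show "2 * (1 - 2 * a * b) \<le> 2 * (1 - 2 * a * b) / gap t"
    using divide_left_mono[of "gap t" 1 "2 * (1 - 2 * a * b)"] g two_ab_less_1 by simp
qed

lemma norm_moment_E4_odd_le:
  assumes \<mu>: "Re \<mu> > - 1 / 2" and m: "odd m"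
  shows "norm (moment_E4 \<mu> m b) \<le> 2 * (b - a) * (LINT t:{0<..<1}|lborel. norm (ultra \<mu> m t))"
  unfolding moment_E4_eq[OF \<mu>]
proof (rule set_integral_norm_le_mult(2)[OF set_integrable_ultra[OF \<mu>]])
  fix t :: real assume "t \<in> {0<..<1}"
  then have t: "0 < t" "t < 1" by auto
  show "\<bar>if even m then 2 else 2 * (1 - 2 * a * b) / gap t\<bar> \<le> 2 * (b - a)"
    using m odd_kernel_bounds[OF t] two_ab_less_1 gap_bounds(4)[OF t] by simp
qed measurable

lemma norm_moment_E4_diff_le:
  assumes \<mu>: "Re \<mu> > - 1 / 2"
  shows "norm (moment_E4 \<mu> m b - 2 * half_range_moment \<mu> m)
    \<le> 4 * a * b * (LINT t:{0<..<1}|lborel. norm (ultra \<mu> m t))"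
proof -
  let ?K = "\<lambda>t. if even m then 2 else 2 * (1 - 2 * a * b) / gap t"
  note int = set_integrable_ultra[OF \<mu>, of m]
  have bound: "\<bar>?K t - 2\<bar> \<le> 4 * a * b" if "t \<in> {0<..<1}" for t
  proof -
    have t: "0 < t" "t < 1" using that by auto
    have "2 * (b - a) \<le> 2" using a_pos b_less_1 by simp
    then show ?thesis
      using odd_kernel_bounds[OF t] a_pos b_pos by (auto simp: abs_le_iff algebra_simps)
  qed
  have K: "set_integrable lborel {0<..<1} (\<lambda>t. ultra \<mu> m t * of_real (?K t))"
  proof (rule set_integral_norm_le_mult(1)[OF int])
    show "\<bar>?K t\<bar> \<le> 4 * a * b + 2" if "t \<in> {0<..<1}" for t
      using bound[OF that] by linarith
  qed measurable
  have "moment_E4 \<mu> m b - 2 * half_range_moment \<mu> m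
      = (LINT t:{0<..<1}|lborel. ultra \<mu> m t * of_real (?K t) - 2 * ultra \<mu> m t)"
    unfolding moment_E4_eq[OF \<mu>] half_range_moment_eq using K int by (subst set_integral_diff) auto
  also have "\<dots> = (LINT t:{0<..<1}|lborel. ultra \<mu> m t * of_real (?K t - 2))"
    by (simp only: of_real_diff of_real_numeral right_diff_distrib mult.commute)
  also have "norm \<dots> \<le> 4 * a * b * (LINT t:{0<..<1}|lborel. norm (ultra \<mu> m t))"
    by (rule set_integral_norm_le_mult(2)[OF int]) (use bound in auto)
  finally show ?thesis .
qed

end

lemma three_intervals_sqrt:
  assumes "1 / sqrt 2 < b" "b < 1"
  shows "three_intervals (sqrt (1 - b^2)) b"
proof
  have b: "0 < b" using assms(1) by (smt (verit) divide_pos_pos real_sqrt_gt_0_iff)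
  have "(1 / sqrt 2)^2 < b^2" using assms(1) by (intro power_strict_mono) auto
  then have half: "1 / 2 < b^2" by (simp add: power_divide)
  have "b^2 < 1" using b assms(2) by (simp add: power_less_one_iff)
  then show "0 < sqrt (1 - b^2)" "(sqrt (1 - b^2))^2 + b^2 = 1" by auto
  show "sqrt (1 - b^2) < b" using half b by (intro real_less_lsqrt) auto
qed

theorem mainTheorem3:
  fixes \<mu> :: complex
  assumes "Re \<mu> > - 1 / 2"
  shows "(\<forall>n. (moment_E4 \<mu> (2 * n + 1) \<longlongrightarrow> 0) (at_right (1 / sqrt 2)))
    \<and> (\<forall>n. (moment_E4 \<mu> (2 * n + 1)
              \<longlongrightarrow> pochhammer 1 n / pochhammer (\<mu> + 1 / 2) (n + 1)) (at_left 1))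
    \<and> (\<forall>m. (moment_E4 \<mu> m \<longlongrightarrow> 2 * half_range_moment \<mu> m) (at_left 1))"
proof -
  have lt: "1 / sqrt 2 < 1" by simp
  define J where "J m = (LINT t:{0<..<1}|lborel. norm (ultra \<mu> m t))" for m
  have lim0: "(moment_E4 \<mu> (2 * n + 1) \<longlongrightarrow> 0) (at_right (1 / sqrt 2))" for n
  proof (rule Lim_null_comparison)
    have "\<forall>\<^sub>F b in at_right (1 / sqrt 2). b \<in> {1 / sqrt 2<..<1}"
      using lt by (rule eventually_at_right_real)
    then show "\<forall>\<^sub>F b in at_right (1 / sqrt 2).
        norm (moment_E4 \<mu> (2 * n + 1) b) \<le> 2 * (b - sqrt (1 - b^2)) * J (2 * n + 1)"
    proof eventually_elim
      case (elim b)
      interpret three_intervals "sqrt (1 - b^2)" b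
        using elim by (intro three_intervals_sqrt) auto
      show ?case
        unfolding J_def by (rule norm_moment_E4_odd_le) (use assms in auto)
    qed
    have "((\<lambda>b. 2 * (b - sqrt (1 - b^2)) * J (2 * n + 1)) \<longlongrightarrow>
        2 * (1 / sqrt 2 - sqrt (1 - (1 / sqrt 2)^2)) * J (2 * n + 1)) (at_right (1 / sqrt 2))"
      by (intro tendsto_intros)
    then show "((\<lambda>b. 2 * (b - sqrt (1 - b^2)) * J (2 * n + 1)) \<longlongrightarrow> 0) (at_right (1 / sqrt 2))"
      by (simp add: power_divide real_sqrt_divide)
  qed
  have lim1: "(moment_E4 \<mu> m \<longlongrightarrow> 2 * half_range_moment \<mu> m) (at_left 1)" for m
  proof (rule LIM_zero_cancel, rule Lim_null_comparison)
    have "\<forall>\<^sub>F b in at_left 1. b \<in> {1 / sqrt 2<..<1}"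
      using lt by (rule eventually_at_left_real)
    then show "\<forall>\<^sub>F b in at_left 1. norm (moment_E4 \<mu> m b - 2 * half_range_moment \<mu> m)
        \<le> 4 * sqrt (1 - b^2) * b * J m"
    proof eventually_elim
      case (elim b)
      interpret three_intervals "sqrt (1 - b^2)" b
        using elim by (intro three_intervals_sqrt) auto
      show ?case
        unfolding J_def by (rule norm_moment_E4_diff_le[OF assms])
    qed
    have "((\<lambda>b. 4 * sqrt (1 - b^2) * b * J m) \<longlongrightarrow> 4 * sqrt (1 - 1^2) * 1 * J m) (at_left 1)"
      by (intro tendsto_intros)
    then show "((\<lambda>b. 4 * sqrt (1 - b^2) * b * J m) \<longlongrightarrow> 0) (at_left 1)"
      by simp
  qed
  have "(moment_E4 \<mu> (2 * n + 1) \<longlongrightarrow> pochhammer 1 n / pochhammer (\<mu> + 1 / 2) (n + 1)) (at_left 1)" for n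
    using lim1[of "2 * n + 1"] unfolding half_range_moment_odd[OF assms] .
  with lim0 lim1 show ?thesis
    by (intro conjI allI)
qed

end
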